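(* Let $F(s,a)\in\mathbb{Z}[s,a]$ be the obstruction polynomial and $\overline{C}\subset\mathbb{P}^2_{\mathbb{Q}}$ the projective plane curve given in the context. Assume that $\overline{C}(\mathbb{Q})$ consists of exactly the following $8$ points $(S:A:Z)$: \[ (1:2:1),\ (0:1:0),\ (0:0:1),\ (0:6:1),\ (1:0:0),\ (-1:2:1),\ (1:0:1),\ (-1:1:0). \] Let $s\in\mathbb{Q}_{>0}$ with $s\neq 1$. Then the quintic $P_s(x)\in\mathbb{Q}[x]$ admits no $2+3$ factorization over $\mathbb{Q}$ (equivalently, it has no quadratic factor over $\mathbb{Q}$).
   Context: For $s\in\mathbb{Q}$, $P_s(x)\in\mathbb{Q}[x]$ is the monic quintic \[ \begin{aligned} P_s(x)={}&x^{5}+(2+s)(3-2s)x^{4}+(1+10s+4s^{2}-14s^{3}+s^{4})x^{3}\\ &-s(1-14s+4s^{2}+10s^{3}+s^{4})x^{2}-s^{3}(1+2s)(-2+3s)x-s^{5}. \end{aligned} \] A monic quintic $P(x)\in K[x]$ over a field $K$ of characteristic $0$ admits a $2+3$ factorization over $K$ if it is divisible in $K[x]$ by a polynomial of degree $2$ (equivalently $P=DH$ with $\deg D=2$, $\deg H=3$ in $K[x]$). Define polynomials in $\mathbb{Z}[s,a]$: \[ \begin{aligned} u={}&-3a^{2}+(12-4s^{2}-2s)a+(-s^{4}+14s^{3}-4s^{2}-10s-1),\\ v={}&a^{4}+(2s^{2}+s-6)a^{3}+(s^{4}-14s^{3}+4s^{2}+10s+1)a^{2}\\ &+(s^{5}+10s^{4}+4s^{3}-14s^{2}+s)a+(-6s^{5}+s^{4}+2s^{3}),\\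 m={}&-2a-2s^{2}-s+6,\\ n={}&a^{3}+(2s^{2}+s-6)a^{2}+(s^{4}-14s^{3}+4s^{2}+10s+1)a+(s^{5}+10s^{4}+4s^{3}-14s^{2}+s), \end{aligned} \] and $L=n-mu$, $C=mv+s^5$, $F=C^2+uLC+vL^2$. The polynomial $F$ has total degree $17$. Let $\widehat F(S,A,Z)=Z^{17}F(S/Z,A/Z)\in\mathbb{Q}[S,A,Z]$ be its homogenization, and let $\overline{C}\subset\mathbb{P}^2_{\mathbb{Q}}$ be the curve $\widehat F(S,A,Z)=0$, with homogeneous coordinates $(S:A:Z)$. *)

theory Defs
  imports Complex_Main "HOL-Computational_Algebra.Computational_Algebra"
begin

definition quintic :: "rat \<Rightarrow> rat poly" where
  "quintic s =
     monom 1 5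
     + monom ((2 + s) * (3 - 2*s)) 4
     + monom (1 + 10*s + 4*s^2 - 14*s^3 + s^4) 3
     - monom (s * (1 - 14*s + 4*s^2 + 10*s^3 + s^4)) 2
     - monom (s^3 * (1 + 2*s) * (-2 + 3*s)) 1
     - monom (s^5) 0"

definition admits_2_3_factorization :: "'a::field_char_0 poly \<Rightarrow> bool" where
  "admits_2_3_factorization P \<longleftrightarrow> (\<exists>D. degree D = 2 \<and> D dvd P)"

lemma admits_2_3_factorization_iff:
  assumes "degree P = 5"
  shows "admits_2_3_factorization P \<longleftrightarrow> (\<exists>D H. degree D = 2 \<and> degree H = 3 \<and> P = D * H)"
proof
  assume "admits_2_3_factorization P"
  then obtain D H where D: "degree D = 2" and P: "P = D * H"
    unfolding admits_2_3_factorization_def by (metis dvdE)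
  have "D \<noteq> 0" "H \<noteq> 0" using assms D P by auto
  then have "degree H = 3" using assms D P by (simp add: degree_mult_eq)
  with D P show "\<exists>D H. degree D = 2 \<and> degree H = 3 \<and> P = D * H" by blast
qed (auto simp: admits_2_3_factorization_def)

text \<open>
  An element of \<open>R[s,a]\<close> is represented as a polynomial in \<open>a\<close> with
  coefficients in \<open>R[s]\<close>, so \<open>coeff (coeff p j) i\<close> is the coefficient of
  \<open>s^i a^j\<close>.
\<close>

definition var_s :: "int poly poly" where "var_s = [:[:0, 1:]:]"
definition var_a :: "int poly poly" where "var_a = [:0, 1:]"

definition obs_u :: "int poly poly" where
  "obs_u = (let s = var_s; a = var_a in
     -3*a^2 + (12 - 4*s^2 - 2*s)*a + (- (s^4) + 14*s^3 - 4*s^2 - 10*s - 1))"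

definition obs_v :: "int poly poly" where
  "obs_v = (let s = var_s; a = var_a in
     a^4 + (2*s^2 + s - 6)*a^3 + (s^4 - 14*s^3 + 4*s^2 + 10*s + 1)*a^2
     + (s^5 + 10*s^4 + 4*s^3 - 14*s^2 + s)*a + (-6*s^5 + s^4 + 2*s^3))"

definition obs_m :: "int poly poly" where
  "obs_m = (let s = var_s; a = var_a in -2*a - 2*s^2 - s + 6)"

definition obs_n :: "int poly poly" where
  "obs_n = (let s = var_s; a = var_a in
     a^3 + (2*s^2 + s - 6)*a^2 + (s^4 - 14*s^3 + 4*s^2 + 10*s + 1)*a
     + (s^5 + 10*s^4 + 4*s^3 - 14*s^2 + s))"

definition obs_L :: "int poly poly" where
  "obs_L = obs_n - obs_m * obs_u"

definition obs_C :: "int poly poly" where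
  "obs_C = obs_m * obs_v + var_s^5"

definition obs_F :: "int poly poly" where
  "obs_F = obs_C^2 + obs_u * obs_L * obs_C + obs_v * obs_L^2"

definition total_degree :: "'a::comm_ring_1 poly poly \<Rightarrow> nat" where
  "total_degree p = Max (insert 0 {i + j | i j. coeff (coeff p j) i \<noteq> 0})"

lemma obs_F_expand:
  "obs_F = [:[:0, 0, 0, 0, 12, -48, -1672, -752, 8308, 1056, -13808, 1056, 8308, -752, -1672, -48, 12:],
   [:0, 0, 6, -96, -214, 13120, -2986, -44608, 11626, 52736, -9086, -29280, 3182, 5568, 34, 0, -2:],
   [:0, 12, 35, -1104, -24666, 5272, 81565, -8884, -103948, 15740, 49725, -5560, -8538, 288, 67, -4:],
   [:6, 34, 2458, 25892, -1818, -84226, 2074, 90936, 2258, -47970, 3790, 7588, -1086, 66, -2:],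
   [:-109, -1686, -17600, -1822, 46489, 13644, -51096, -5028, 18361, 1242, -2784, 338, -13:],
   [:684, 6688, 5102, -16352, -9074, 9152, 9302, -4032, -1850, 608, -36:],
   [:-1623, -2304, 839, 6156, -1000, -2804, 39, 512, -55:],
   [:918, 98, -670, -692, 362, 194, -50:],
   [:-219, 42, 126, 18, -27:],
   [:24, -4, -8:],
   [:-1:]:]"
  unfolding obs_F_def obs_C_def obs_L_def obs_u_def obs_v_def obs_m_def obs_n_def
    var_s_def var_a_def Let_def
  by (simp add: numeral_poly eval_nat_numeral one_pCons)

lemma coeff_pCons_if: "coeff (pCons c p) n = (if n = 0 then c else coeff p (n - 1))"
  by (cases n) auto

lemma obs_F_degree_le: "coeff (coeff obs_F j) i \<noteq> 0 \<Longrightarrow> i + j \<le> 17"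
  unfolding obs_F_expand by (auto simp: coeff_pCons_if split: if_splits)

lemma total_degree_obs_F: "total_degree obs_F = 17"
proof -
  let ?T = "insert 0 {i + j | i j. coeff (coeff obs_F j) i \<noteq> 0}"
  have le: "?T \<subseteq> {..17}" using obs_F_degree_le by auto
  have "coeff (coeff obs_F 1) 16 \<noteq> 0"
    unfolding obs_F_expand by (simp add: coeff_pCons_if)
  then have "16 + 1 \<in> ?T" by blast
  then have "17 \<in> ?T" by simp
  moreover have "finite ?T" by (rule finite_subset[OF le]) simp
  ultimately have "Max ?T = 17" using le by (intro Max_eqI) auto
  then show ?thesis by (simp add: total_degree_def)
qed

text \<open>
  The homogenization in degree \<open>d\<close>, an element of \<open>R[S,A,Z]\<close> nested as
  \<open>R[S][A][Z]\<close>: each monomial \<open>s^i a^j\<close> becomes \<open>S^i A^j Z^(d-i-j)\<close>.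
  Since subtraction on naturals truncates, this is meaningful only if \<open>d\<close> is at
  least the total degree of \<open>p\<close>.
\<close>

definition homogenize :: "nat \<Rightarrow> 'a::comm_ring_1 poly poly \<Rightarrow> 'a poly poly poly" where
  "homogenize d p =
     (\<Sum>j\<le>degree p. \<Sum>i\<le>degree (coeff p j).
        monom (monom (monom (coeff (coeff p j) i) i) j) (d - i - j))"

definition eval2 :: "'a::comm_ring_1 poly poly \<Rightarrow> 'a \<Rightarrow> 'a \<Rightarrow> 'a" where
  "eval2 p s a = poly (poly p [:a:]) s"

definition eval3 :: "'a::comm_ring_1 poly poly poly \<Rightarrow> 'a \<Rightarrow> 'a \<Rightarrow> 'a \<Rightarrow> 'a" where
  "eval3 G S A Z = poly (poly (poly G [:[:Z:]:]) [:A:]) S"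

lemma eval3_homogenize:
  fixes p :: "'a::field poly poly"
  assumes "\<And>i j. coeff (coeff p j) i \<noteq> 0 \<Longrightarrow> i + j \<le> d" "Z \<noteq> 0"
  shows "eval3 (homogenize d p) S A Z = Z^d * eval2 p (S/Z) (A/Z)"
proof -
  have t: "Z^(d-i-j) * coeff (coeff p j) i * S^i * A^j =
      Z^d * (coeff (coeff p j) i * (S/Z)^i * (A/Z)^j)" for i j
  proof (cases "coeff (coeff p j) i = 0")
    case False
    then have "i + j \<le> d" by (rule assms)
    then have "d = (d-i-j) + i + j" by simp
    then have "Z^d = Z^(d-i-j) * Z^i * Z^j" by (metis power_add)
    with assms(2) show ?thesis by (simp add: field_simps)
  qed simp
  have "eval3 (homogenize d p) S A Z =
      (\<Sum>j\<le>degree p. \<Sum>i\<le>degree (coeff p j). Z^(d-i-j) * coeff (coeff p j) i * S^i * A^j)"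
    by (simp add: eval3_def homogenize_def poly_sum poly_monom poly_const_pow algebra_simps)
  also have "\<dots> = Z^d * (\<Sum>j\<le>degree p. \<Sum>i\<le>degree (coeff p j). coeff (coeff p j) i * (S/Z)^i * (A/Z)^j)"
    by (simp only: t sum_distrib_left)
  also have "(\<Sum>j\<le>degree p. \<Sum>i\<le>degree (coeff p j). coeff (coeff p j) i * (S/Z)^i * (A/Z)^j) =
      eval2 p (S/Z) (A/Z)"
    by (simp add: eval2_def poly_altdef[of p] poly_sum poly_const_pow sum_distrib_right)
      (simp add: poly_altdef mult.commute sum_distrib_left)
  finally show ?thesis .
qed

definition obs_F_rat :: "rat poly poly" where
  "obs_F_rat = map_poly (map_poly of_int) obs_F"

definition obs_F_hom :: "rat poly poly poly" where
  "obs_F_hom = homogenize 17 obs_F_rat"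

lemma eval3_obs_F_hom:
  assumes "Z \<noteq> 0"
  shows "eval3 obs_F_hom S A Z = Z^17 * eval2 obs_F_rat (S/Z) (A/Z)"
  unfolding obs_F_hom_def
proof (rule eval3_homogenize)
  fix i j assume "coeff (coeff obs_F_rat j) i \<noteq> 0"
  then show "i + j \<le> 17"
    by (intro obs_F_degree_le) (auto simp: obs_F_rat_def coeff_map_poly)
qed fact

text \<open>
  A point of the projective plane is the set of all its homogeneous coordinate vectors.
\<close>

definition proj_point :: "'a::field \<Rightarrow> 'a \<Rightarrow> 'a \<Rightarrow> ('a \<times> 'a \<times> 'a) set" where
  "proj_point S A Z = {(c * S, c * A, c * Z) | c. c \<noteq> 0}"

definition plane_curve_points :: "'a::field poly poly poly \<Rightarrow> ('a \<times> 'a \<times> 'a) set set" where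
  "plane_curve_points G =
     {proj_point S A Z | S A Z. (S, A, Z) \<noteq> (0, 0, 0) \<and> eval3 G S A Z = 0}"

end

(* Write a monic quadratic factor as x^2 + a x + b.  Comparing coefficients determines the cubic
   cofactor and leaves two equations for b, namely b^2 + u b + v = 0 and m b^2 + n b = s^5.
   Eliminating b^2 from the second gives L b = C, so F(s,a) = L^2 (b^2 + u b + v) = 0 and (s:a:1)
   is a rational point of the curve.  The listed points with Z = 1 all have S in {-1, 0, 1}. *)

theory Submission
  imports Defs
begin

lemma quintic_pCons:
  "quintic s = [:- (s^5), - (s^3 * (1 + 2*s) * (-2 + 3*s)),
     - (s * (1 - 14*s + 4*s^2 + 10*s^3 + s^4)), 1 + 10*s + 4*s^2 - 14*s^3 + s^4,
     (2 + s) * (3 - 2*s), 1:]"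
  by (simp add: quintic_def monom_altdef eval_nat_numeral)

lemma degree_quintic: "degree (quintic s) = 5"
  by (simp add: quintic_pCons)

text \<open>The elimination is purely formal, so the coefficients stay arbitrary in an integral
  domain. Multiplying by \<open>L^2\<close> instead of dividing by \<open>L\<close> also covers the
  case \<open>L = 0\<close>.\<close>

lemma monic_quadratic_factor_imp_root:
  fixes a b e f g c0 c1 c2 c3 c4 :: "'a::idom"
  defines "u \<equiv> - 3*a^2 + 2*c4*a - c3"
    and "m \<equiv> c4 - 2*a"
    and "n \<equiv> a^3 - c4*a^2 + c3*a - c2"
  defines "v \<equiv> a*n + c1"
  defines "L \<equiv> n - m*u" and "C \<equiv> m*v - c0"
  assumes "[:c0, c1, c2, c3, c4, 1:] = [:b, a, 1:] * [:g, f, e, 1:]"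
  shows "C^2 + u*L*C + v*L^2 = 0"
proof -
  have c: "c4 = a + e" "c3 = b + a*e + f" "c2 = b*e + a*f + g" "c1 = b*f + a*g" "c0 = b*g"
    using assms(7) by (auto simp: algebra_simps)
  \<comment> \<open>Solving for \<open>e\<close>, \<open>f\<close>, \<open>g\<close> from the top
    gives \<open>g = -(m*b + n)\<close>. The equations for \<open>c1\<close> and \<open>c0\<close>
    then become this one and the next.\<close>
  have "b^2 + u*b + v = 0"
    unfolding u_def v_def n_def c by (simp add: algebra_simps power2_eq_square power3_eq_cube)
  moreover have "m*b^2 + n*b + c0 = 0"
    unfolding m_def n_def c by (simp add: algebra_simps power2_eq_square power3_eq_cube)
  \<comment> \<open>Subtract \<open>m\<close> times the first equation from the second.\<close>
  ultimately have "L*b = C"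
    unfolding L_def C_def by algebra
  then have "C^2 + u*L*C + v*L^2 = L^2 * (b^2 + u*b + v)"
    by (auto simp: algebra_simps power2_eq_square)
  with \<open>b^2 + u*b + v = 0\<close> show ?thesis by simp
qed

text \<open>Identifies the integer polynomial \<open>obs_F\<close> with the formal expression above,
  specialised to the coefficients of \<open>quintic s\<close>; for instance
  \<open>c4 = 6 - s - 2*s^2\<close>.\<close>

lemma eval2_obs_F_rat:
  fixes s a :: rat
  defines "c4 \<equiv> (2 + s) * (3 - 2*s)" and "c3 \<equiv> 1 + 10*s + 4*s^2 - 14*s^3 + s^4"
    and "c2 \<equiv> - (s * (1 - 14*s + 4*s^2 + 10*s^3 + s^4))"
    and "c1 \<equiv> - (s^3 * (1 + 2*s) * (-2 + 3*s))" and "c0 \<equiv> - (s^5)"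
  defines "u \<equiv> - 3*a^2 + 2*c4*a - c3" and "m \<equiv> c4 - 2*a"
    and "n \<equiv> a^3 - c4*a^2 + c3*a - c2"
  defines "v \<equiv> a*n + c1"
  defines "L \<equiv> n - m*u" and "C \<equiv> m*v - c0"
  shows "eval2 obs_F_rat s a = C^2 + u*L*C + v*L^2"
  unfolding assms eval2_def obs_F_rat_def obs_F_expand
  by (simp add: map_poly_pCons) algebra

lemma proj_point_affine_eq:
  assumes "proj_point s a 1 = proj_point S A 1"
  shows "s = S \<and> a = A"
proof -
  have "(s, a, 1) \<in> proj_point s a 1"
    unfolding proj_point_def by force
  with assms show ?thesis
    by (auto simp: proj_point_def)
qed

lemma proj_point_affine_neq_infinite: "proj_point s a 1 \<noteq> proj_point S A 0"
proof
  assume "proj_point s a 1 = proj_point S A 0"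
  moreover have "(s, a, 1) \<in> proj_point s a 1"
    unfolding proj_point_def by force
  ultimately show False
    by (auto simp: proj_point_def)
qed

text \<open>The witness \<open>a\<close> is the linear coefficient of the quadratic factor once that
  is made monic.\<close>

lemma factorization_imp_curve_point:
  assumes "admits_2_3_factorization (quintic s)"
  shows "\<exists>a. proj_point s a 1 \<in> plane_curve_points obs_F_hom"
proof -
  obtain D H where deg: "degree D = 2" "degree H = 3" and DH: "quintic s = D * H"
    using assms admits_2_3_factorization_iff[OF degree_quintic] by auto
  define l where "l = lead_coeff D"
  have "l \<noteq> 0" using deg unfolding l_def by (metis degree_0 leading_coeff_0_iff zero_neq_numeral)
  have "lead_coeff D * lead_coeff H = 1"
    by (simp flip: lead_coeff_mult DH add: quintic_pCons)
  then have "lead_coeff H = inverse l"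
    using \<open>l \<noteq> 0\<close> by (simp add: l_def field_simps)
  \<comment> \<open>Since the quintic is monic, moving the scalar \<open>l\<close> from
    \<open>D\<close> to \<open>H\<close> makes both factors monic.\<close>
  define D' H' where "D' = smult (inverse l) D" and "H' = smult l H"
  have prod: "quintic s = D' * H'"
    using DH \<open>l \<noteq> 0\<close> by (simp add: D'_def H'_def)
  have "degree D' = 2" "coeff D' 2 = 1" "degree H' = 3" "coeff H' 3 = 1"
    using deg \<open>l \<noteq> 0\<close> \<open>lead_coeff H = inverse l\<close> l_def by (simp_all add: D'_def H'_def)
  then have "D' = [:coeff D' 0, coeff D' 1, 1:]" "H' = [:coeff H' 0, coeff H' 1, coeff H' 2, 1:]"
    by (auto simp: poly_eq_iff coeff_pCons coeff_eq_0 eval_nat_numeral split: nat.split)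
  with prod obtain a b e f g where "quintic s = [:b, a, 1:] * [:g, f, e, 1:]"
    by metis
  then have "eval2 obs_F_rat s a = 0"
    unfolding eval2_obs_F_rat quintic_pCons by (rule monic_quadratic_factor_imp_root)
  then have "eval3 obs_F_hom s a 1 = 0"
    by (simp add: eval3_obs_F_hom)
  then show ?thesis
    unfolding plane_curve_points_def by force
qed

theorem theorem1:
  fixes s :: rat
  assumes "plane_curve_points obs_F_hom =
             {proj_point 1 2 1, proj_point 0 1 0, proj_point 0 0 1, proj_point 0 6 1,
              proj_point 1 0 0, proj_point (-1) 2 1, proj_point 1 0 1, proj_point (-1) 1 0}"
    and "s > 0" and "s \<noteq> 1"
  shows "\<not> admits_2_3_factorization (quintic s)"
proof
  assume "admits_2_3_factorization (quintic s)"
  then obtain a where "proj_point s a 1 \<in> plane_curve_points obs_F_hom"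
    using factorization_imp_curve_point by blast
  \<comment> \<open>The three listed points with last coordinate 0 are excluded; each of the other
    five determines \<open>s\<close>.\<close>
  then have "s \<in> {-1, 0, 1}"
    unfolding assms(1)
    by (auto simp: proj_point_affine_neq_infinite dest: proj_point_affine_eq)
  with assms(2,3) show False by auto
qed

end
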